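(* Let $m'=6j+1$ be a prime, where $j$ is a positive integer. Then for every integer $n\ge0$ such that $n\equiv\varepsilon a\pmod{6m'}$ for some $\varepsilon\in\{1,-1\}$ and $a\in\{0,1,2,2m'-1,2m'+2\}$, and for every $i\in\{0,1,\ldots,m'-1\}$, $$\#\{\lambda\in P(n,3):\lambda_1-\lambda_3\equiv i\pmod{m'}\}=\frac{p(n,3)}{m'};$$ that is, $c_{LS}(\lambda)=\lambda_1-\lambda_3\bmod m'$ is a crank witnessing $p(n,3)\equiv0\pmod{m'}$ for all such $n$.
   Context: $P(n,3)$ is the set of partitions of $n$ into exactly three parts, identified with integer vectors $\lambda=(\lambda_1,\lambda_2,\lambda_3)$ with $\lambda_1+\lambda_2+\lambda_3=n$ and $\lambda_1\ge\lambda_2\ge\lambda_3>0$; $p(n,3)=\#P(n,3)$. *)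

theory Defs
  imports Complex_Main "HOL-Number_Theory.Cong" "HOL-Computational_Algebra.Primes"
begin

definition P3 :: "int \<Rightarrow> (int \<times> int \<times> int) set" where
  "P3 n = {(l1, l2, l3). l1 + l2 + l3 = n \<and> l1 \<ge> l2 \<and> l2 \<ge> l3 \<and> l3 > 0}"

definition p3 :: "int \<Rightarrow> nat" where
  "p3 n = card (P3 n)"

definition c_LS :: "int \<Rightarrow> int \<times> int \<times> int \<Rightarrow> int" where
  "c_LS m = (\<lambda>(l1, l2, l3). (l1 - l3) mod m)"

text \<open>A statistic \<open>c\<close>, with values in the residues \<open>0, \<dots>, m - 1\<close>, is a crank witnessing that
  \<open>m\<close> divides the size of the finite set \<open>A\<close> if it splits \<open>A\<close> into \<open>m\<close> classes of
  equal size.\<close>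

definition crank_witnesses :: "('a \<Rightarrow> int) \<Rightarrow> 'a set \<Rightarrow> int \<Rightarrow> bool" where
  "crank_witnesses c A m \<longleftrightarrow>
     finite A \<and> c ` A \<subseteq> {0..<m} \<and> [int (card A) = 0] (mod m) \<and>
     (\<forall>i\<in>{0..<m}. real (card {x \<in> A. c x = i}) = real (card A) / real_of_int m)"

end

theory Submission
  imports Defs
begin

text \<open>A partition in \<open>P3 n\<close> with \<open>\<lambda>\<^sub>1 - \<lambda>\<^sub>3 = s\<close> is determined by its smallest part, which ranges
  over an interval, so there are
  \<open>max 0 \<lfloor>(n - s) / 3\<rfloor> - max 0 \<lfloor>(n - 2 * s - 1) / 3\<rfloor>\<close> of them. Summing over \<open>s \<equiv> i\<close>
  modulo \<open>m = 6 * j + 1\<close> and shifting \<open>s\<close> by \<open>6 * m\<close> in the first term and by \<open>3 * m\<close> in the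
  second, one finds that passing from \<open>n\<close> to \<open>n + 6 * m\<close> increases the size of each residue class
  by \<open>n + 3 * m\<close>, whatever \<open>i\<close> is. This leaves finitely many base cases with
  \<open>-2 \<le> n \<le> 4 * m + 1\<close>, where the sum has at most six terms.\<close>

section \<open>Counting by the gap between the largest and the smallest part\<close>

definition gap_count :: "int \<Rightarrow> int \<Rightarrow> int" where
  "gap_count n s = max 0 ((n - s) div 3) - max 0 ((n - 2 * s - 1) div 3)"

lemma finite_P3: "finite (P3 n)"
proof (rule finite_subset)
  show "P3 n \<subseteq> {0..n} \<times> {0..n} \<times> {0..n}"
    by (auto simp: P3_def)
qed simp

lemma card_P3_gap:
  assumes "s \<ge> 0"
  shows "int (card {(l1, l2, l3) \<in> P3 n. l1 - l3 = s}) = gap_count n s"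
proof -
  \<comment> \<open>With smallest part \<open>c\<close> and gap \<open>s\<close> the middle part is
    \<open>n - s - 2 * c\<close>. Its two order constraints read
    \<open>n - 2 * s \<le> 3 * c \<le> n - s\<close>; the \<open>- 1\<close> accounts for the open
    left end.\<close>
  let ?I = "{max 0 ((n - 2 * s - 1) div 3)<..(n - s) div 3}"
  let ?f = "\<lambda>c. (c + s, n - s - 2 * c, c)"
  have I: "c \<in> ?I \<longleftrightarrow> c > 0 \<and> 3 * c \<ge> n - 2 * s \<and> 3 * c \<le> n - s" for c
    by auto
  have "{(l1, l2, l3) \<in> P3 n. l1 - l3 = s} = ?f ` ?I"
  proof (intro set_eqI iffI)
    fix x assume "x \<in> {(l1, l2, l3) \<in> P3 n. l1 - l3 = s}"
    then obtain l1 l2 l3 where x: "x = (l1, l2, l3)" "(l1, l2, l3) \<in> P3 n" "l1 - l3 = s"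
      by auto
    then have "x = ?f l3" and "l3 \<in> ?I"
      unfolding I by (auto simp: P3_def)
    then show "x \<in> ?f ` ?I" by blast
  next
    fix x assume "x \<in> ?f ` ?I"
    then obtain c where "x = ?f c" "c \<in> ?I" by blast
    then show "x \<in> {(l1, l2, l3) \<in> P3 n. l1 - l3 = s}"
      unfolding I by (auto simp: P3_def)
  qed
  moreover have "inj_on ?f ?I" by (auto simp: inj_on_def)
  ultimately have "card {(l1, l2, l3) \<in> P3 n. l1 - l3 = s} = card ?I"
    by (simp add: card_image)
  \<comment> \<open>With the endpoints in order, clipping both at 0 gives the length of the interval
    even when it is empty.\<close>
  moreover have "(n - 2 * s - 1) div 3 \<le> (n - s) div 3"
    using assms by (intro zdiv_mono1) auto
  ultimately show ?thesis
    by (auto simp: gap_count_def)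
qed

text \<open>Every gap is nonnegative and smaller than \<open>n\<close>, so the quotients of gaps by
  \<open>m\<close> stay below any \<open>K\<close> with \<open>n \<le> m * int K\<close>. The cutoff
  stays free because it must grow along with \<open>n\<close> in the induction.\<close>

lemma card_P3_residue:
  assumes m: "m > 0" and i: "i \<in> {0..m - 1}" and K: "n \<le> m * int K"
  shows "int (card {(l1, l2, l3) \<in> P3 n. [l1 - l3 = i] (mod m)})
    = (\<Sum>k<K. gap_count n (i + m * int k))"
proof -
  let ?A = "\<lambda>k::nat. {(l1, l2, l3) \<in> P3 n. l1 - l3 = i + m * int k}"
  have "{(l1, l2, l3) \<in> P3 n. [l1 - l3 = i] (mod m)} = (\<Union>k<K. ?A k)"
  proof (intro set_eqI iffI)
    fix x assume "x \<in> {(l1, l2, l3) \<in> P3 n. [l1 - l3 = i] (mod m)}"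
    then obtain l1 l2 l3 where x: "x = (l1, l2, l3)" "(l1, l2, l3) \<in> P3 n"
      and c: "[l1 - l3 = i] (mod m)"
      by auto
    let ?q = "(l1 - l3) div m"
    have "(l1 - l3) mod m = i" using c i by (auto simp: cong_def)
    then have eq: "l1 - l3 = i + m * ?q"
      by (metis add.commute mult_div_mod_eq)
    have "l1 - l3 \<ge> 0" "l1 - l3 < n" using x by (auto simp: P3_def)
    then have "?q \<ge> 0"
      using m by (simp only: pos_imp_zdiv_nonneg_iff)
    have "i \<ge> 0" using i by simp
    with eq \<open>l1 - l3 < n\<close> K have "m * ?q < m * int K" by linarith
    then have "?q < int K"
      using m by (simp only: mult_less_cancel_left_pos)
    then have "nat ?q < K" and "l1 - l3 = i + m * int (nat ?q)"
      using \<open>?q \<ge> 0\<close> eq by (auto simp: nat_less_iff)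
    then show "x \<in> (\<Union>k<K. ?A k)" using x by blast
  next
    fix x assume "x \<in> (\<Union>k<K. ?A k)"
    then show "x \<in> {(l1, l2, l3) \<in> P3 n. [l1 - l3 = i] (mod m)}"
      by (auto simp: cong_def)
  qed
  moreover have "card (\<Union>k<K. ?A k) = (\<Sum>k<K. card (?A k))"
  proof (rule card_UN_disjoint)
    show "\<forall>k\<in>{..<K}. finite (?A k)"
      using finite_P3[of n] by (auto intro: rev_finite_subset)
    show "\<forall>k\<in>{..<K}. \<forall>k'\<in>{..<K}. k \<noteq> k' \<longrightarrow> ?A k \<inter> ?A k' = {}"
      using m by auto
  qed simp
  ultimately have "int (card {(l1, l2, l3) \<in> P3 n. [l1 - l3 = i] (mod m)})
      = (\<Sum>k<K. int (card (?A k)))" by simp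
  also have "\<dots> = (\<Sum>k<K. gap_count n (i + m * int k))"
    using m i by (intro sum.cong refl card_P3_gap) auto
  finally show ?thesis .
qed

section \<open>Floors of thirds: the period \<open>6 * m\<close> and the base cases\<close>

lemma int_mod_3_cases:
  fixes x :: int
  obtains q where "x = 3 * q" | q where "x = 3 * q + 1" | q where "x = 3 * q + 2"
proof -
  have "x = 3 * (x div 3) + x mod 3" "x mod 3 = 0 \<or> x mod 3 = 1 \<or> x mod 3 = 2" by auto
  then show thesis using that by (metis add.right_neutral)
qed

text \<open>A form of Hermite's identity: the remainders of three consecutive integers modulo 3 add
  up to 3.\<close>

lemma sum_three_floors: "x div 3 + (x - 1) div 3 + (x - 2) div 3 = x - (2::int)"
proof -
  have "(y + 2) div 3 + (y + 1) div 3 + y div 3 = y" for y :: int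
    by (cases y rule: int_mod_3_cases) auto
  from this[of "x - 2"] show ?thesis by simp
qed

lemma sum_lessThan_add: "(\<Sum>k<a + b. f k) = (\<Sum>k<a. f k) + (\<Sum>k<b. f (a + k))"
  for f :: "nat \<Rightarrow> 'a::comm_monoid_add"
  by (induction b) (simp_all add: ac_simps)

lemma gap_sum_period:
  fixes j m n i :: int
  assumes j: "j > 0" and m: "m = 6 * j + 1" and n: "n \<ge> -2" and i: "i \<in> {0..m - 1}"
    and K: "n \<le> m * int K"
  shows "(\<Sum>k<6 + K. gap_count (n + 6 * m) (i + m * int k))
    = (\<Sum>k<K. gap_count n (i + m * int k)) + n + 3 * m"
proof -
  let ?g = "\<lambda>x::int. max 0 (x div 3)"
  let ?x = "n + 6 * m - i" and ?y = "n + 6 * m - 1 - 2 * i"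
  have "(\<Sum>k<6 + K. ?g (?x - m * int k))
      = (\<Sum>k<6. ?g (?x - m * int k)) + (\<Sum>k<K. ?g (n - (i + m * int k)))"
    unfolding sum_lessThan_add by (simp add: algebra_simps)
  moreover have "(\<Sum>k<6 + K. ?g (?y - 2 * m * int k))
      = (\<Sum>k<3. ?g (?y - 2 * m * int k)) + (\<Sum>k<K. ?g (n - 2 * (i + m * int k) - 1))"
  proof -
    \<comment> \<open>The second sum is shifted by three indices but has six new ones; the three at
      the far end vanish because \<open>n \<le> m * int K\<close>.\<close>
    have "?g (?y - 2 * m * int (3 + K + k)) = 0" for k
    proof -
      have "m * int K \<ge> 0" "m * int k \<ge> 0" using j m by auto
      moreover have "2 * m * int (3 + K + k)
          = 6 * m + 2 * (m * int K) + 2 * (m * int k)"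
        by (simp add: algebra_simps)
      ultimately have "?y - 2 * m * int (3 + K + k) < 0"
        using i K unfolding atLeastAtMost_iff by linarith
      then have "(?y - 2 * m * int (3 + K + k)) div 3 < 0"
        by (simp only: pos_imp_zdiv_neg_iff)
      then show ?thesis by simp
    qed
    moreover have "6 + K = 3 + K + 3" by simp
    ultimately have "(\<Sum>k<6 + K. ?g (?y - 2 * m * int k)) = (\<Sum>k<3 + K. ?g (?y - 2 * m * int k))"
      by (simp only: sum_lessThan_add[of _ "3 + K" 3]) simp
    then show ?thesis
      unfolding sum_lessThan_add by (simp add: algebra_simps)
  qed
  moreover have "(\<Sum>k<6. ?g (?x - m * int k)) - (\<Sum>k<3. ?g (?y - 2 * m * int k)) = n + 3 * m"
  proof -
    \<comment> \<open>Since \<open>m\<close> is 1 modulo 3, steps of \<open>m\<close> become steps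
      of 1, at a cost linear in \<open>k\<close>.\<close>
    have x: "(?x - m * k) div 3 = (?x - k) div 3 - 2 * j * k" for k
    proof -
      have "?x - m * k = ?x - k + 3 * (- 2 * j * k)" by (simp add: m algebra_simps)
      then show ?thesis by (simp only: div_mult_self2)
    qed
    have y: "(?y - 2 * m * k) div 3 = (?y - 2 * k) div 3 - 4 * j * k" for k
    proof -
      have "?y - 2 * m * k = ?y - 2 * k + 3 * (- 4 * j * k)" by (simp add: m algebra_simps)
      then show ?thesis by (simp only: div_mult_self2)
    qed
    \<comment> \<open>Only for \<open>n = -2\<close> and \<open>i = m - 1\<close> can the last arguments be negative, and then they agree.\<close>
    have last: "?g (?x - m * 5) - ?g (?y - 2 * m * 2)
        = (?x - m * 5) div 3 - (?y - 2 * m * 2) div 3"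
    proof (cases "n = -2 \<and> i = m - 1")
      case True
      then show ?thesis by simp
    next
      case False
      then have "?x - m * 5 \<ge> 0" "?y - 2 * m * 2 \<ge> 0" using n i by auto
      then show ?thesis by (simp only: max_absorb2 pos_imp_zdiv_nonneg_iff)
    qed
    have gx: "?g (?x - m * k) = (?x - m * k) div 3" if "k \<in> {0, 1, 2, 3, 4}" for k
    proof -
      have "m * k \<le> m * 4" using that j m by (intro mult_left_mono) auto
      then have "?x - m * k \<ge> 0" using n i j m by auto
      then show ?thesis by (simp only: max_absorb2 pos_imp_zdiv_nonneg_iff)
    qed
    have gy: "?g (?y - 2 * m * k) = (?y - 2 * m * k) div 3" if "k \<in> {0, 1}" for k
    proof -
      have "2 * m * k \<le> 2 * m * 1" using that j m by (intro mult_left_mono) auto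
      then have "?y - 2 * m * k \<ge> 0" using n i j m unfolding atLeastAtMost_iff by linarith
      then show ?thesis by (simp only: max_absorb2 pos_imp_zdiv_nonneg_iff)
    qed
    have "(\<Sum>k<6. ?g (?x - m * int k)) - (\<Sum>k<3. ?g (?y - 2 * m * int k))
        = ?g (?x - m * 0) + ?g (?x - m * 1) + ?g (?x - m * 2) + ?g (?x - m * 3) + ?g (?x - m * 4)
          - ?g (?y - 2 * m * 0) - ?g (?y - 2 * m * 1)
          + (?g (?x - m * 5) - ?g (?y - 2 * m * 2))"
      by (simp add: eval_nat_numeral)
    \<comment> \<open>The linear costs add up to \<open>2 * j * (0 + 1 + 2 + 3 + 4 + 5) - 4 * j * (0
      + 1 + 2) = 18 * j\<close>.\<close>
    also have "\<dots> = (?x div 3 + (?x - 1) div 3 + (?x - 2) div 3)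
          + ((?x - 3) div 3 + (?x - 4) div 3 + (?x - 5) div 3)
          - (?y div 3 + (?y - 2) div 3 + (?y - 4) div 3) - 18 * j"
      unfolding last
      by (simp only: gx gy insert_iff simp_thms) (simp only: x y, simp)
    also have "\<dots> = n + 3 * m"
    proof -
      have x2: "(?x - 3) div 3 + (?x - 4) div 3 + (?x - 5) div 3 = ?x - 5"
      proof -
        have "(x - 3) div 3 + (x - 4) div 3 + (x - 5) div 3 = x - 5" for x :: int
          using sum_three_floors[of "x - 3"] by simp
        then show ?thesis .
      qed
      \<comment> \<open>Steps of 2 also run through all residues modulo 3.\<close>
      have y3: "?y div 3 + (?y - 2) div 3 + (?y - 4) div 3 = ?y - 3"
      proof -
        have "y div 3 + (y - 2) div 3 + (y - 4) div 3 = y - 3" for y :: int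
          by (cases y rule: int_mod_3_cases; simp; presburger)
        then show ?thesis .
      qed
      show ?thesis unfolding sum_three_floors x2 y3 by (simp add: m)
    qed
    finally show ?thesis .
  qed
  ultimately show ?thesis
    by (simp add: gap_count_def sum_subtractf algebra_simps)
qed

text \<open>Once the vanishing terms are dropped, each case is a floor identity in one variable,
  settled by its residue modulo 3. Six terms cover all gaps since
  \<open>r \<le> 6 * m\<close>.\<close>

lemma gap_sum_base:
  fixes j m r i :: int
  assumes j: "j > 0" and m: "m = 6 * j + 1" and i: "i \<in> {0..m - 1}"
    and r: "r \<in> {-2, -1, 0, 1, 2, 2 * m - 1, 2 * m + 2, 4 * m - 2, 4 * m + 1}"
  shows "(\<Sum>k<6. gap_count r (i + m * int k)) =
    (if r \<le> 2 then 0 else if r = 2 * m - 1 then 2 * j else if r = 2 * m + 2 then 2 * j + 1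
     else if r = 4 * m - 2 then 8 * j else 8 * j + 2)" (is "?S = _")
proof -
  \<comment> \<open>Reflecting \<open>i\<close> makes the arguments grow with a nonnegative
    variable, so that it is visible which floors survive the clipping.\<close>
  define t where "t = m - 1 - i"
  have t: "t \<ge> 0" "t \<le> 6 * j" and i_eq: "i = 6 * j - t"
    using i by (auto simp: t_def m)
  \<comment> \<open>The bound 3 instead of 0 matters: for \<open>r = 2 * m + 2\<close> the dropped
    argument \<open>t + 2 - 6 * j\<close> can reach 2.\<close>
  have g0: "max 0 (x div 3) = 0" if "x < 3" for x :: int using that by simp
  have g1: "max 0 (x div 3) = x div 3" if "x \<ge> 0" for x :: int
    using that by (simp add: pos_imp_zdiv_nonneg_iff)
  have shift: "(x + 6 * j) div 3 = x div 3 + 2 * j" "(x + 12 * j) div 3 = x div 3 + 4 * j"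
    "(x + 18 * j) div 3 = x div 3 + 6 * j" for x :: int
    using div_mult_self1[of 3 x "2 * j"] div_mult_self1[of 3 x "4 * j"]
      div_mult_self1[of 3 x "6 * j"] by (simp_all add: mult.commute)
  have six: "(\<Sum>k<6. f k) = f 0 + f 1 + f 2 + f 3 + f 4 + f 5" for f :: "nat \<Rightarrow> int"
    by (simp add: eval_nat_numeral)
  consider "r \<in> {-2..2}" | "r = 2 * m - 1" | "r = 2 * m + 2" | "r = 4 * m - 2" | "r = 4 * m + 1"
    using r by auto
  then show ?thesis
  proof cases
    case 1
    then have "gap_count r (i + m * int k) = 0" for k
    proof -
      have "m * int k \<ge> 0" using j m by auto
      then show ?thesis
        using 1 i g0[of "r - (i + m * int k)"] g0[of "r - 2 * (i + m * int k) - 1"]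
        by (simp add: gap_count_def)
    qed
    then show ?thesis using 1 by simp
  next
    case 2
    then have "?S = (t + 1 + 6 * j) div 3 + t div 3 - (2 * t) div 3"
      unfolding six gap_count_def using t j by (simp add: g0 g1 i_eq m algebra_simps)
    also have "\<dots> = 2 * j"
      unfolding shift by (cases t rule: int_mod_3_cases) auto
    finally show ?thesis using 2 j m by simp
  next
    case 3
    then have "?S = (t + 4 + 6 * j) div 3 + (t + 3) div 3 - (2 * t + 3) div 3"
      unfolding six gap_count_def using t j by (simp add: g0 g1 i_eq m algebra_simps)
    also have "\<dots> = 2 * j + 1"
      unfolding shift by (cases t rule: int_mod_3_cases) auto
    finally show ?thesis using 3 j m by simp
  next
    case 4
    have "?S = 8 * j"
    \<comment> \<open>Here the arguments \<open>t - 1\<close> and \<open>2 * t - 1\<close> occur;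
      both are -1 at \<open>t = 0\<close> and clipped, and nonnegative otherwise.\<close>
    proof (cases "t = 0")
      case True
      with 4 have "?S = (2 + 18 * j) div 3 + (1 + 12 * j) div 3 + (0 + 6 * j) div 3
          - (1 + 12 * j) div 3"
        unfolding six gap_count_def using j by (simp add: g0 g1 i_eq m add.commute)
      then show ?thesis unfolding shift by simp
    next
      case False
      define u where "u = t - 1"
      have u: "t = u + 1" "u \<ge> 0" using False t by (auto simp: u_def)
      with 4 have "?S = (u + 3 + 18 * j) div 3 + (u + 2 + 12 * j) div 3 + (u + 1 + 6 * j) div 3
          + u div 3 - (2 * u + 3 + 12 * j) div 3 - (2 * u + 1) div 3"
        unfolding six gap_count_def using t j by (simp add: g0 g1 i_eq m algebra_simps)
      also have "\<dots> = 8 * j"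
        unfolding shift by (cases u rule: int_mod_3_cases; simp; presburger)
      finally show ?thesis .
    qed
    then show ?thesis using 4 j m by simp
  next
    case 5
    then have "?S = (t + 5 + 18 * j) div 3 + (t + 4 + 12 * j) div 3 + (t + 3 + 6 * j) div 3
        + (t + 2) div 3 - (2 * t + 4 + 12 * j) div 3 - (2 * t + 2) div 3"
      unfolding six gap_count_def using t j by (simp add: g0 g1 i_eq m algebra_simps)
    also have "\<dots> = 8 * j + 2"
      unfolding shift by (cases t rule: int_mod_3_cases; simp; presburger)
    finally show ?thesis using 5 j m by simp
  qed
qed

section \<open>Equal class sizes for all admissible \<open>n\<close>\<close>

lemma gap_sum_const:
  fixes j m r :: int and q :: nat
  assumes j: "j > 0" and m: "m = 6 * j + 1"
    and r: "r \<in> {-2, -1, 0, 1, 2, 2 * m - 1, 2 * m + 2, 4 * m - 2, 4 * m + 1}"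
  shows "\<exists>c. \<forall>i\<in>{0..m - 1}.
    (\<Sum>k<6 * (q + 1). gap_count (6 * m * int q + r) (i + m * int k)) = c"
proof (induction q)
  case 0
  then show ?case using gap_sum_base[OF j m _ r] by auto
next
  case (Suc q)
  let ?n = "6 * m * int q + r"
  obtain c where c: "(\<Sum>k<6 * (q + 1). gap_count ?n (i + m * int k)) = c"
    if "i \<in> {0..m - 1}" for i using Suc by blast
  have "6 * m * int q \<ge> 0" using j m by simp
  moreover have "r \<ge> -2" using r j m by auto
  ultimately have n: "?n \<ge> -2" by linarith
  \<comment> \<open>All listed \<open>r\<close> are at most \<open>6 * m\<close>, so six further
    terms per period suffice.\<close>
  have K: "?n \<le> m * int (6 * (q + 1))" using r j m by (auto simp: algebra_simps)
  have eqs: "6 * (Suc q + 1) = 6 + 6 * (q + 1)" "6 * m * int (Suc q) + r = ?n + 6 * m"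
    by (simp_all add: algebra_simps)
  have "(\<Sum>k<6 * (Suc q + 1). gap_count (6 * m * int (Suc q) + r) (i + m * int k))
      = c + ?n + 3 * m" if "i \<in> {0..m - 1}" for i
    unfolding eqs gap_sum_period[OF j m n that K] c[OF that] ..
  then show ?case by blast
qed

text \<open>Modulo \<open>6 * m\<close> the negatives of \<open>2 * m - 1\<close> and
  \<open>2 * m + 2\<close> become \<open>4 * m + 1\<close> and \<open>4 * m - 2\<close>. The
  residues -1 and -2 stay negative, which makes their base cases empty.\<close>

lemma cong_six_representative:
  fixes m n a e :: int
  assumes m: "m \<ge> 4" and n: "n \<ge> 0" and e: "e \<in> {1, -1}"
    and a: "a \<in> {0, 1, 2, 2 * m - 1, 2 * m + 2}" and c: "[n = e * a] (mod (6 * m))"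
  obtains q :: nat and r
    where "n = 6 * m * int q + r"
      and "r \<in> {-2, -1, 0, 1, 2, 2 * m - 1, 2 * m + 2, 4 * m - 2, 4 * m + 1}"
proof -
  let ?R = "{-2, -1, 0, 1, 2, 2 * m - 1, 2 * m + 2, 4 * m - 2, 4 * m + 1}"
  have "\<exists>r\<in>?R. [e * a = r] (mod (6 * m))"
  proof (cases "e * a \<in> ?R")
    case True
    then show ?thesis by (blast intro: cong_refl)
  next
    case False
    moreover have "e * a \<in> ?R \<or> e * a + 6 * m \<in> ?R"
      using e a by (elim insertE emptyE) simp_all
    ultimately have "e * a + 6 * m \<in> ?R" by blast
    moreover have "[e * a = e * a + 6 * m] (mod (6 * m))" by (simp add: cong_def)
    ultimately show ?thesis by blast
  qed
  then obtain r where r: "r \<in> ?R" "[n = r] (mod (6 * m))"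
    using c cong_trans by blast
  obtain k where "n = r + 6 * m * k"
    using cong_sym[OF r(2)] unfolding cong_iff_lin by blast
  then have k: "n = 6 * m * k + r" by simp
  \<comment> \<open>Every listed \<open>r\<close> is below \<open>6 * m\<close>, so a negative
    \<open>k\<close> would make \<open>n\<close> negative.\<close>
  have "k \<ge> 0"
  proof (rule ccontr)
    assume "\<not> k \<ge> 0"
    then have "m * k \<le> m * (-1)" using m by (intro mult_left_mono) auto
    then show False using k n r(1) m by auto
  qed
  then show thesis using that[of "nat k" r] k r(1) by simp
qed

theorem theorem4:
  fixes j m' :: int
  assumes "j > 0" and "m' = 6 * j + 1" and "prime m'"
  shows "\<forall>n \<ge> 0. (\<exists>\<epsilon> \<in> {1, -1}. \<exists>a \<in> {0, 1, 2, 2 * m' - 1, 2 * m' + 2}. [n = \<epsilon> * a] (mod (6 * m'))) \<longrightarrow>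
      (\<forall>i \<in> {0..m' - 1}.
         real (card {(l1, l2, l3) \<in> P3 n. [l1 - l3 = i] (mod m')}) = real (p3 n) / real_of_int m')
      \<and> [int (p3 n) = 0] (mod m')
      \<and> crank_witnesses (c_LS m') (P3 n) m'"
proof (intro allI impI)
  fix n :: int
  assume n: "n \<ge> 0"
    and "\<exists>\<epsilon> \<in> {1, -1}. \<exists>a \<in> {0, 1, 2, 2 * m' - 1, 2 * m' + 2}. [n = \<epsilon> * a] (mod (6 * m'))"
  then obtain e a where ea: "e \<in> {1, -1}" "a \<in> {0, 1, 2, 2 * m' - 1, 2 * m' + 2}"
    "[n = e * a] (mod (6 * m'))" by blast
  have m: "m' > 0" "m' \<ge> 4" using assms by auto
  obtain q :: nat and r where q: "n = 6 * m' * int q + r"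
    and r: "r \<in> {-2, -1, 0, 1, 2, 2 * m' - 1, 2 * m' + 2, 4 * m' - 2, 4 * m' + 1}"
    using cong_six_representative[OF m(2) n ea] .
  let ?C = "\<lambda>i. {(l1, l2, l3) \<in> P3 n. [l1 - l3 = i] (mod m')}"
  have K: "n \<le> m' * int (6 * (q + 1))" using q r m by (auto simp: algebra_simps)
  obtain c where c: "int (card (?C i)) = c" if "i \<in> {0..m' - 1}" for i
    using gap_sum_const[OF assms(1,2) r, of q] card_P3_residue[OF m(1) _ K] q by auto
  have crank_class: "?C i = {x \<in> P3 n. c_LS m' x = i}" if "i \<in> {0..m' - 1}" for i
    using that by (auto simp: c_LS_def cong_def)
  have range: "c_LS m' ` P3 n \<subseteq> {0..m' - 1}"
    using m(1) by (auto simp: c_LS_def)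
  \<comment> \<open>The fibres of the statistic partition \<open>P3 n\<close>; since they share the
    size \<open>c\<close>, divisibility by \<open>m'\<close> follows from equidistribution.\<close>
  have "card (P3 n) = (\<Sum>i\<in>{0..m' - 1}. card {x \<in> P3 n. c_LS m' x = i})"
    using sum.group[OF finite_P3 _ range, of "\<lambda>_. 1::nat"] by simp
  then have "int (card (P3 n)) = (\<Sum>i\<in>{0..m' - 1}. int (card (?C i)))"
    by (simp add: crank_class)
  also have "\<dots> = m' * c" using m(1) by (simp add: c)
  finally have total: "int (card (P3 n)) = m' * c" .
  have "real_of_int (int (card (P3 n))) = real_of_int m' * real_of_int c"
    unfolding total by simp
  then have "real (card (P3 n)) = real_of_int m' * real_of_int c" by simp
  moreover have "real (card (?C i)) = real_of_int c" if "i \<in> {0..m' - 1}" for i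
    unfolding c[OF that, symmetric] by simp
  ultimately have equal: "real (card (?C i)) = real (card (P3 n)) / real_of_int m'"
    if "i \<in> {0..m' - 1}" for i
    using that m(1) by simp
  have dvd: "[int (card (P3 n)) = 0] (mod m')"
    by (simp add: total cong_def)
  have "crank_witnesses (c_LS m') (P3 n) m'"
    unfolding crank_witnesses_def
    using finite_P3 range dvd equal by (auto simp: crank_class)
  then show "(\<forall>i \<in> {0..m' - 1}. real (card (?C i)) = real (p3 n) / real_of_int m')
      \<and> [int (p3 n) = 0] (mod m') \<and> crank_witnesses (c_LS m') (P3 n) m'"
    using equal dvd unfolding p3_def by blast
qed

end
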